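(* Let $\mathcal N\subseteq\mathcal B(\mathcal H)$ be a von Neumann algebra and $\mathcal S\subseteq\mathcal B(\mathcal H)$ a finite set such that the commutant $\mathcal S'$ is a von Neumann algebra and there is a normal conditional expectation $E_{\mathrm{fix}}:\mathcal N\to\mathcal S'\cap\mathcal N$ (fixed). Let $\Phi_1,\Phi_2$ be channels on $\mathcal N$ with $\Phi_i\circ E_{\mathrm{fix}}=E_{\mathrm{fix}}$ for $i=1,2$. Then $$|\mathrm{Cost}^{cb}_{\mathcal S}(\Phi_2)-\mathrm{Cost}^{cb}_{\mathcal S}(\Phi_1)|\le\kappa(\mathcal S)\,\|\Phi_1-\Phi_2\|_{cb},$$ $$|\mathrm{Lip}^{cb}_{\mathcal S}(\Phi_2)-\mathrm{Lip}^{cb}_{\mathcal S}(\Phi_1)|\le2\sup_{s\in\mathcal S}\|s\|_{op}\,\kappa(\mathcal S)\,\|\Phi_1-\Phi_2\|_{cb},$$ where $\kappa(\mathcal S)=\mathrm{Cost}^{cb}_{\mathcal S}(E_{\mathrm{fix}})$.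
   Context: A channel is a normal unital completely positive map $\Phi:\mathcal N\to\mathcal N$; $\Phi^{(n)}=\mathrm{id}_{\mathbb M_n}\otimes\Phi$; $\|\cdot\|_{cb}$ is the completely bounded norm. For $x\in\mathbb M_n(\mathcal N)$ put $|||x|||_{\mathcal S^{(n)}}=\sup_{s\in\mathcal S}\|[\mathbb I_n\otimes s,x]\|_{op}$. Then $$\mathrm{Cost}_{\mathcal S}^{cb}(\Phi)=\sup_{n\ge1}\sup\{\|\Phi^{(n)}(x)-x\|_{op}: x=x^*\in\mathbb M_n(\mathcal N),\ |||x|||_{\mathcal S^{(n)}}\le1\},$$ $$\mathrm{Lip}_{\mathcal S}^{cb}(\Phi)=\sup_{n\ge1}\sup\{|||\Phi^{(n)}(x)|||_{\mathcal S^{(n)}}: x=x^*\in\mathbb M_n(\mathcal N),\ |||x|||_{\mathcal S^{(n)}}\le1\}.$$ *)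

theory Defs
  imports "HOL-Analysis.Analysis"
begin

section \<open>Complex Hilbert spaces and their bounded operators\<close>

text \<open>A complex Hilbert space, presented on top of its underlying real Hilbert space.
  The complex inner product is linear in the second argument; its real part is the real
  inner product, so that the norm is the one induced by \<open>cinner\<close>.\<close>

class chilbert_space = real_inner + complete_space +
  fixes scaleC :: "complex \<Rightarrow> 'a \<Rightarrow> 'a"
    and cinner :: "'a \<Rightarrow> 'a \<Rightarrow> complex"
  assumes scaleC_add_right: "scaleC c (x + y) = scaleC c x + scaleC c y"
    and scaleC_add_left: "scaleC (c + d) x = scaleC c x + scaleC d x"
    and scaleC_scaleC: "scaleC c (scaleC d x) = scaleC (c * d) x"
    and scaleC_of_real: "scaleC (complex_of_real r) x = scaleR r x"
    and cinner_add_right: "cinner x (y + z) = cinner x y + cinner x z"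
    and cinner_scaleC_right: "cinner x (scaleC c y) = c * cinner x y"
    and cinner_commute: "cinner x y = cnj (cinner y x)"
    and Re_cinner: "Re (cinner x y) = inner x y"

text \<open>B(H): the complex-linear operators among the bounded real-linear ones. The norm and
  composition of type \<open>blinfun\<close> are the usual ones of B(H).\<close>

definition bounded_ops :: "('h::chilbert_space \<Rightarrow>\<^sub>L 'h) set" where
  "bounded_ops = {T. \<forall>c \<xi>. blinfun_apply T (scaleC c \<xi>) = scaleC c (blinfun_apply T \<xi>)}"

definition cscale :: "complex \<Rightarrow> ('h::chilbert_space \<Rightarrow>\<^sub>L 'h) \<Rightarrow> ('h \<Rightarrow>\<^sub>L 'h)" where
  "cscale c T = Blinfun (\<lambda>\<xi>. scaleC c (blinfun_apply T \<xi>))"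

lemma norm_scaleC: "norm (scaleC c x) = cmod c * norm (x::'h::chilbert_space)"
proof -
  have left: "cinner (scaleC c x) y = cnj c * cinner x y" for y :: 'h
    by (metis cinner_commute cinner_scaleC_right complex_cnj_mult)
  have "cnj c * c = complex_of_real ((cmod c)\<^sup>2)"
    by (metis complex_norm_square mult.commute)
  then have "cinner (scaleC c x) (scaleC c x) = complex_of_real ((cmod c)\<^sup>2) * cinner x x"
    by (metis left cinner_scaleC_right mult.assoc)
  then have "inner (scaleC c x) (scaleC c x) = (cmod c)\<^sup>2 * inner x x"
    by (metis Re_cinner scaleR_complex.sel(1) scaleR_conv_of_real)
  then have "(norm (scaleC c x))\<^sup>2 = (cmod c * norm x)\<^sup>2"
    by (simp add: power2_norm_eq_inner power_mult_distrib)
  then show ?thesis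
    by (simp add: power2_eq_iff_nonneg)
qed

lemma cscale_apply: "blinfun_apply (cscale c T) \<xi> = scaleC c (blinfun_apply T \<xi>)"
proof -
  have "bounded_linear (\<lambda>\<xi>. scaleC c \<xi> :: 'a)"
  proof (rule bounded_linear_intro[where K = "cmod c"])
    show "scaleC c (r *\<^sub>R x) = r *\<^sub>R scaleC c x" for r :: real and x :: 'a
      by (metis mult.commute scaleC_of_real scaleC_scaleC)
  qed (auto simp: scaleC_add_right norm_scaleC)
  then have "bounded_linear (\<lambda>\<xi>. scaleC c (blinfun_apply T \<xi>))"
    using blinfun.bounded_linear_right bounded_linear_compose by blast
  then show ?thesis
    by (simp add: cscale_def bounded_linear_Blinfun_apply)
qed

text \<open>\<open>is_adjoint T R\<close> says that \<open>R\<close> is the (unique) adjoint of \<open>T\<close>.\<close>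

definition is_adjoint ::
    "('h::chilbert_space \<Rightarrow>\<^sub>L 'h) \<Rightarrow> ('h \<Rightarrow>\<^sub>L 'h) \<Rightarrow> bool" where
  "is_adjoint T R \<longleftrightarrow>
     (\<forall>\<xi> \<eta>. cinner (blinfun_apply T \<xi>) \<eta> = cinner \<xi> (blinfun_apply R \<eta>))"

definition selfadjoint_part ::
    "('h::chilbert_space \<Rightarrow>\<^sub>L 'h) set \<Rightarrow> ('h \<Rightarrow>\<^sub>L 'h) set" where
  "selfadjoint_part N = {T \<in> N. is_adjoint T T}"

definition commutant :: "('h::chilbert_space \<Rightarrow>\<^sub>L 'h) set \<Rightarrow> ('h \<Rightarrow>\<^sub>L 'h) set" where
  "commutant A = {T \<in> bounded_ops. \<forall>a\<in>A. T o\<^sub>L a = a o\<^sub>L T}"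

definition von_neumann_algebra :: "('h::chilbert_space \<Rightarrow>\<^sub>L 'h) set \<Rightarrow> bool" where
  "von_neumann_algebra N \<longleftrightarrow>
     N \<subseteq> bounded_ops \<and> id_blinfun \<in> N \<and>
     (\<forall>a\<in>N. \<forall>b\<in>N. a + b \<in> N) \<and>
     (\<forall>a\<in>N. \<forall>b\<in>N. a o\<^sub>L b \<in> N) \<and>
     (\<forall>c. \<forall>a\<in>N. cscale c a \<in> N) \<and>
     (\<forall>a\<in>N. \<exists>b\<in>N. is_adjoint a b) \<and>
     commutant (commutant N) = N"

section \<open>Matrices of operators\<close>

text \<open>An element of \<open>M\<^sub>n(B(H))\<close> is a family \<open>x i j\<close> and a vector of \<open>H\<^sup>n\<close> a family \<open>\<xi> i\<close>;
  only the values at indices below \<open>n\<close> are relevant. Matrices act on the Hilbert space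
  \<open>H\<^sup>n\<close>, which is the tensor product of \<open>C\<^sup>n\<close> and H.\<close>

definition vec_inner ::
    "nat \<Rightarrow> (nat \<Rightarrow> 'h::chilbert_space) \<Rightarrow> (nat \<Rightarrow> 'h) \<Rightarrow> complex" where
  "vec_inner n \<xi> \<eta> = (\<Sum>i<n. cinner (\<xi> i) (\<eta> i))"

definition vec_norm :: "nat \<Rightarrow> (nat \<Rightarrow> 'h::chilbert_space) \<Rightarrow> real" where
  "vec_norm n \<xi> = sqrt (\<Sum>i<n. (norm (\<xi> i))\<^sup>2)"

definition mat_apply ::
    "nat \<Rightarrow> (nat \<Rightarrow> nat \<Rightarrow> ('h::chilbert_space \<Rightarrow>\<^sub>L 'h)) \<Rightarrow> (nat \<Rightarrow> 'h) \<Rightarrow> (nat \<Rightarrow> 'h)" where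
  "mat_apply n x \<xi> = (\<lambda>i. \<Sum>j<n. blinfun_apply (x i j) (\<xi> j))"

definition mat_norm :: "nat \<Rightarrow> (nat \<Rightarrow> nat \<Rightarrow> ('h::chilbert_space \<Rightarrow>\<^sub>L 'h)) \<Rightarrow> real" where
  "mat_norm n x = (SUP \<xi>\<in>{\<xi>. vec_norm n \<xi> \<le> 1}. vec_norm n (mat_apply n x \<xi>))"

definition mats ::
    "nat \<Rightarrow> ('h::chilbert_space \<Rightarrow>\<^sub>L 'h) set \<Rightarrow> (nat \<Rightarrow> nat \<Rightarrow> ('h \<Rightarrow>\<^sub>L 'h)) set" where
  "mats n N = {x. \<forall>i<n. \<forall>j<n. x i j \<in> N}"

definition mat_selfadjoint ::
    "nat \<Rightarrow> (nat \<Rightarrow> nat \<Rightarrow> ('h::chilbert_space \<Rightarrow>\<^sub>L 'h)) \<Rightarrow> bool" where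
  "mat_selfadjoint n x \<longleftrightarrow> (\<forall>i<n. \<forall>j<n. is_adjoint (x i j) (x j i))"

definition mat_positive ::
    "nat \<Rightarrow> (nat \<Rightarrow> nat \<Rightarrow> ('h::chilbert_space \<Rightarrow>\<^sub>L 'h)) \<Rightarrow> bool" where
  "mat_positive n x \<longleftrightarrow> (\<forall>\<xi>. vec_inner n \<xi> (mat_apply n x \<xi>) \<in> \<real>\<^sub>\<ge>\<^sub>0)"

definition mat_mult ::
    "nat \<Rightarrow> (nat \<Rightarrow> nat \<Rightarrow> ('h::chilbert_space \<Rightarrow>\<^sub>L 'h)) \<Rightarrow>
     (nat \<Rightarrow> nat \<Rightarrow> ('h \<Rightarrow>\<^sub>L 'h)) \<Rightarrow> (nat \<Rightarrow> nat \<Rightarrow> ('h \<Rightarrow>\<^sub>L 'h))" where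
  "mat_mult n x y = (\<lambda>i j. \<Sum>k<n. x i k o\<^sub>L y k j)"

definition mat_diff ::
    "(nat \<Rightarrow> nat \<Rightarrow> ('h::chilbert_space \<Rightarrow>\<^sub>L 'h)) \<Rightarrow>
     (nat \<Rightarrow> nat \<Rightarrow> ('h \<Rightarrow>\<^sub>L 'h)) \<Rightarrow> (nat \<Rightarrow> nat \<Rightarrow> ('h \<Rightarrow>\<^sub>L 'h))" where
  "mat_diff x y = (\<lambda>i j. x i j - y i j)"

text \<open>The operator \<open>I\<^sub>n \<otimes> s\<close>.\<close>

definition amplify :: "('h::chilbert_space \<Rightarrow>\<^sub>L 'h) \<Rightarrow> (nat \<Rightarrow> nat \<Rightarrow> ('h \<Rightarrow>\<^sub>L 'h))" where
  "amplify s = (\<lambda>i j. if i = j then s else 0)"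

definition mat_commutator ::
    "nat \<Rightarrow> (nat \<Rightarrow> nat \<Rightarrow> ('h::chilbert_space \<Rightarrow>\<^sub>L 'h)) \<Rightarrow>
     (nat \<Rightarrow> nat \<Rightarrow> ('h \<Rightarrow>\<^sub>L 'h)) \<Rightarrow> (nat \<Rightarrow> nat \<Rightarrow> ('h \<Rightarrow>\<^sub>L 'h))" where
  "mat_commutator n x y = mat_diff (mat_mult n x y) (mat_mult n y x)"

text \<open>The map \<open>id \<otimes> \<Phi>\<close> on matrices.\<close>

definition mat_map ::
    "(('h::chilbert_space \<Rightarrow>\<^sub>L 'h) \<Rightarrow> ('h \<Rightarrow>\<^sub>L 'h)) \<Rightarrow>
     (nat \<Rightarrow> nat \<Rightarrow> ('h \<Rightarrow>\<^sub>L 'h)) \<Rightarrow> (nat \<Rightarrow> nat \<Rightarrow> ('h \<Rightarrow>\<^sub>L 'h))" where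
  "mat_map \<Phi> x = (\<lambda>i j. \<Phi> (x i j))"

section \<open>Channels and conditional expectations\<close>

text \<open>Maps between operator algebras are total functions of which only the restriction to
  the domain algebra is relevant.\<close>

definition linear_map_on ::
    "('h::chilbert_space \<Rightarrow>\<^sub>L 'h) set \<Rightarrow> (('h \<Rightarrow>\<^sub>L 'h) \<Rightarrow> ('h \<Rightarrow>\<^sub>L 'h)) \<Rightarrow> bool" where
  "linear_map_on N \<Phi> \<longleftrightarrow>
     (\<forall>a\<in>N. \<forall>b\<in>N. \<Phi> (a + b) = \<Phi> a + \<Phi> b) \<and>
     (\<forall>c. \<forall>a\<in>N. \<Phi> (cscale c a) = cscale c (\<Phi> a))"

definition completely_positive_on ::
    "('h::chilbert_space \<Rightarrow>\<^sub>L 'h) set \<Rightarrow> (('h \<Rightarrow>\<^sub>L 'h) \<Rightarrow> ('h \<Rightarrow>\<^sub>L 'h)) \<Rightarrow> bool" where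
  "completely_positive_on N \<Phi> \<longleftrightarrow>
     (\<forall>n\<ge>1. \<forall>x\<in>mats n N. mat_positive n x \<longrightarrow> mat_positive n (mat_map \<Phi> x))"

definition ucp_map ::
    "('h::chilbert_space \<Rightarrow>\<^sub>L 'h) set \<Rightarrow> ('h \<Rightarrow>\<^sub>L 'h) set \<Rightarrow>
     (('h \<Rightarrow>\<^sub>L 'h) \<Rightarrow> ('h \<Rightarrow>\<^sub>L 'h)) \<Rightarrow> bool" where
  "ucp_map N M \<Phi> \<longleftrightarrow>
     \<Phi> ` N \<subseteq> M \<and> linear_map_on N \<Phi> \<and> \<Phi> id_blinfun = id_blinfun \<and> completely_positive_on N \<Phi>"

definition op_le :: "('h::chilbert_space \<Rightarrow>\<^sub>L 'h) \<Rightarrow> ('h \<Rightarrow>\<^sub>L 'h) \<Rightarrow> bool" where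
  "op_le a b \<longleftrightarrow> (\<forall>\<xi>. cinner \<xi> (blinfun_apply (b - a) \<xi>) \<in> \<real>\<^sub>\<ge>\<^sub>0)"

definition op_is_sup ::
    "('h::chilbert_space \<Rightarrow>\<^sub>L 'h) set \<Rightarrow> ('h \<Rightarrow>\<^sub>L 'h) set \<Rightarrow> ('h \<Rightarrow>\<^sub>L 'h) \<Rightarrow> bool" where
  "op_is_sup N D a \<longleftrightarrow>
     a \<in> selfadjoint_part N \<and> (\<forall>d\<in>D. op_le d a) \<and>
     (\<forall>b\<in>selfadjoint_part N. (\<forall>d\<in>D. op_le d b) \<longrightarrow> op_le a b)"

text \<open>Normality of a positive map: it preserves suprema of bounded increasing nets of
  self-adjoint elements. Since the map is monotone, nets may be replaced by directed sets;
  boundedness is implied by the existence of the supremum.\<close>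

definition normal_map ::
    "('h::chilbert_space \<Rightarrow>\<^sub>L 'h) set \<Rightarrow> ('h \<Rightarrow>\<^sub>L 'h) set \<Rightarrow>
     (('h \<Rightarrow>\<^sub>L 'h) \<Rightarrow> ('h \<Rightarrow>\<^sub>L 'h)) \<Rightarrow> bool" where
  "normal_map N M \<Phi> \<longleftrightarrow>
     (\<forall>D a. D \<subseteq> selfadjoint_part N \<and> D \<noteq> {} \<and>
            (\<forall>d\<in>D. \<forall>e\<in>D. \<exists>f\<in>D. op_le d f \<and> op_le e f) \<and> op_is_sup N D a \<longrightarrow>
            op_is_sup M (\<Phi> ` D) (\<Phi> a))"

definition channel ::
    "('h::chilbert_space \<Rightarrow>\<^sub>L 'h) set \<Rightarrow> (('h \<Rightarrow>\<^sub>L 'h) \<Rightarrow> ('h \<Rightarrow>\<^sub>L 'h)) \<Rightarrow> bool" where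
  "channel N \<Phi> \<longleftrightarrow> ucp_map N N \<Phi> \<and> normal_map N N \<Phi>"

definition conditional_expectation ::
    "('h::chilbert_space \<Rightarrow>\<^sub>L 'h) set \<Rightarrow> ('h \<Rightarrow>\<^sub>L 'h) set \<Rightarrow>
     (('h \<Rightarrow>\<^sub>L 'h) \<Rightarrow> ('h \<Rightarrow>\<^sub>L 'h)) \<Rightarrow> bool" where
  "conditional_expectation N M E \<longleftrightarrow>
     M \<subseteq> N \<and> ucp_map N M E \<and> (\<forall>m\<in>M. E m = m) \<and>
     (\<forall>a\<in>M. \<forall>b\<in>M. \<forall>x\<in>N. E (a o\<^sub>L x o\<^sub>L b) = a o\<^sub>L E x o\<^sub>L b)"

section \<open>Cost and Lipschitz constants\<close>

text \<open>All suprema below are taken in \<open>[0,\<infinity>]\<close>, as they may be infinite; the supremum over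
  an empty set is \<open>0\<close>, and \<open>0 \<cdot> \<infinity> = 0\<close>.\<close>

definition cb_norm ::
    "('h::chilbert_space \<Rightarrow>\<^sub>L 'h) set \<Rightarrow> (('h \<Rightarrow>\<^sub>L 'h) \<Rightarrow> ('h \<Rightarrow>\<^sub>L 'h)) \<Rightarrow> ennreal" where
  "cb_norm N \<Psi> =
     (SUP n\<in>{1..}. SUP x\<in>{x \<in> mats n N. mat_norm n x \<le> 1}. ennreal (mat_norm n (mat_map \<Psi> x)))"

definition lip_seminorm ::
    "('h::chilbert_space \<Rightarrow>\<^sub>L 'h) set \<Rightarrow> nat \<Rightarrow> (nat \<Rightarrow> nat \<Rightarrow> ('h \<Rightarrow>\<^sub>L 'h)) \<Rightarrow> ennreal" where
  "lip_seminorm S n x = (SUP s\<in>S. ennreal (mat_norm n (mat_commutator n (amplify s) x)))"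

definition lip_ball ::
    "('h::chilbert_space \<Rightarrow>\<^sub>L 'h) set \<Rightarrow> ('h \<Rightarrow>\<^sub>L 'h) set \<Rightarrow> nat \<Rightarrow>
     (nat \<Rightarrow> nat \<Rightarrow> ('h \<Rightarrow>\<^sub>L 'h)) set" where
  "lip_ball N S n = {x \<in> mats n N. mat_selfadjoint n x \<and> lip_seminorm S n x \<le> 1}"

definition Cost_cb ::
    "('h::chilbert_space \<Rightarrow>\<^sub>L 'h) set \<Rightarrow> ('h \<Rightarrow>\<^sub>L 'h) set \<Rightarrow>
     (('h \<Rightarrow>\<^sub>L 'h) \<Rightarrow> ('h \<Rightarrow>\<^sub>L 'h)) \<Rightarrow> ennreal" where
  "Cost_cb N S \<Phi> =
     (SUP n\<in>{1..}. SUP x\<in>lip_ball N S n. ennreal (mat_norm n (mat_diff (mat_map \<Phi> x) x)))"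

definition Lip_cb ::
    "('h::chilbert_space \<Rightarrow>\<^sub>L 'h) set \<Rightarrow> ('h \<Rightarrow>\<^sub>L 'h) set \<Rightarrow>
     (('h \<Rightarrow>\<^sub>L 'h) \<Rightarrow> ('h \<Rightarrow>\<^sub>L 'h)) \<Rightarrow> ennreal" where
  "Lip_cb N S \<Phi> = (SUP n\<in>{1..}. SUP x\<in>lip_ball N S n. lip_seminorm S n (mat_map \<Phi> x))"

text \<open>The absolute difference \<open>\<bar>a - b\<bar>\<close> on \<open>[0,\<infinity>]\<close> with the convention \<open>\<bar>\<infinity> - \<infinity>\<bar> = 0\<close>;
  subtraction on \<open>ennreal\<close> is truncated, and would give \<open>\<infinity> - \<infinity> = \<infinity>\<close>.\<close>

definition abs_diff :: "ennreal \<Rightarrow> ennreal \<Rightarrow> ennreal" where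
  "abs_diff a b = (if a = b then 0 else max (a - b) (b - a))"

lemma abs_diff_ennreal:
  assumes "0 \<le> a" "0 \<le> b"
  shows "abs_diff (ennreal a) (ennreal b) = ennreal \<bar>a - b\<bar>"
proof (cases "a \<le> b")
  case True
  then show ?thesis
    using assms by (auto simp: abs_diff_def ennreal_minus ennreal_neg max_def)
next
  case False
  then show ?thesis
    using assms by (auto simp: abs_diff_def ennreal_minus ennreal_neg max_def)
qed

lemma abs_diff_top: "a \<noteq> \<infinity> \<Longrightarrow> abs_diff a \<infinity> = \<infinity>" "a \<noteq> \<infinity> \<Longrightarrow> abs_diff \<infinity> a = \<infinity>"
  by (auto simp: abs_diff_def ennreal_top_minus max_def top_unique)

end

theory Submission
  imports Defs
begin

text \<open>Both channels fix the range of \<open>Efix\<close>, so \<open>\<Phi>1 - \<Phi>2\<close> takes the same values at \<open>x\<close> and at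
  \<open>x - Efix x\<close>, and the norm of the latter is at most \<open>\<kappa>(S)\<close> on the Lipschitz ball. The
  first estimate is then the triangle inequality; the second one uses in addition that the
  commutator seminorm is at most \<open>2 sup \<parallel>s\<parallel>\<close> times the norm.\<close>

section \<open>Operator norms of matrices\<close>

text \<open>Places the norm of \<open>H^n\<close> in the theory of \<open>L2_set\<close>, whose
  monotonicity and Minkowski inequality supply the norm facts below.\<close>

lemma vec_norm_L2_set: "vec_norm n \<xi> = L2_set (\<lambda>i. norm (\<xi> i)) {..<n}"
  by (simp add: vec_norm_def L2_set_def)

lemma vec_norm_nonneg: "0 \<le> vec_norm n \<xi>"
  by (simp add: vec_norm_L2_set)

lemma vec_norm_mono:
  assumes "\<And>i. i < n \<Longrightarrow> norm (\<xi> i) \<le> norm (\<eta> i)"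
  shows "vec_norm n \<xi> \<le> vec_norm n \<eta>"
  unfolding vec_norm_L2_set by (rule L2_set_mono) (use assms in auto)

lemma vec_norm_triangle: "vec_norm n (\<lambda>i. \<xi> i + \<eta> i) \<le> vec_norm n \<xi> + vec_norm n \<eta>"
proof -
  have "vec_norm n (\<lambda>i. \<xi> i + \<eta> i) \<le> L2_set (\<lambda>i. norm (\<xi> i) + norm (\<eta> i)) {..<n}"
    unfolding vec_norm_L2_set by (rule L2_set_mono) (auto intro: norm_triangle_ineq)
  also have "\<dots> \<le> vec_norm n \<xi> + vec_norm n \<eta>"
    unfolding vec_norm_L2_set by (rule L2_set_triangle_ineq)
  finally show ?thesis .
qed

lemma vec_norm_scaleR: "vec_norm n (\<lambda>i. r *\<^sub>R \<xi> i) = \<bar>r\<bar> * vec_norm n \<xi>"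
  by (simp add: vec_norm_L2_set L2_set_right_distrib)

lemma vec_norm_blinfun_apply_le:
  "vec_norm n (\<lambda>i. blinfun_apply s (\<xi> i)) \<le> norm s * vec_norm n \<xi>"
proof -
  have "vec_norm n (\<lambda>i. blinfun_apply s (\<xi> i)) \<le> vec_norm n (\<lambda>i. norm s *\<^sub>R \<xi> i)"
    by (rule vec_norm_mono) (simp add: norm_blinfun)
  then show ?thesis
    by (simp add: vec_norm_scaleR)
qed

lemma norm_le_vec_norm: "i < n \<Longrightarrow> norm (\<xi> i) \<le> vec_norm n \<xi>"
  unfolding vec_norm_L2_set by (rule member_le_L2_set) auto

text \<open>A crude bound whose purpose is finiteness: \<open>mat_norm\<close> is a supremum of
  reals, which carries information only when the set of values is bounded above.\<close>

lemma vec_norm_mat_apply_le_sum: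
  assumes "vec_norm n \<xi> \<le> 1"
  shows "vec_norm n (mat_apply n x \<xi>) \<le> (\<Sum>i<n. \<Sum>j<n. norm (x i j))"
proof -
  have "vec_norm n (mat_apply n x \<xi>) \<le> (\<Sum>i<n. norm (mat_apply n x \<xi> i))"
    unfolding vec_norm_L2_set by (rule L2_set_le_sum) auto
  also have "\<dots> \<le> (\<Sum>i<n. \<Sum>j<n. norm (x i j))"
  proof (rule sum_mono)
    fix i
    have "norm (mat_apply n x \<xi> i) \<le> (\<Sum>j<n. norm (blinfun_apply (x i j) (\<xi> j)))"
      unfolding mat_apply_def by (rule norm_sum)
    also have "\<dots> \<le> (\<Sum>j<n. norm (x i j))"
    proof (rule sum_mono)
      fix j assume "j \<in> {..<n}"
      then have "norm (\<xi> j) \<le> 1"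
        using norm_le_vec_norm[of j n \<xi>] assms by simp
      then show "norm (blinfun_apply (x i j) (\<xi> j)) \<le> norm (x i j)"
        by (meson mult_left_le norm_blinfun norm_ge_zero order_trans)
    qed
    finally show "norm (mat_apply n x \<xi> i) \<le> (\<Sum>j<n. norm (x i j))" .
  qed
  finally show ?thesis .
qed

lemma vec_norm_mat_apply_le_mat_norm:
  assumes "vec_norm n \<xi> \<le> 1"
  shows "vec_norm n (mat_apply n x \<xi>) \<le> mat_norm n x"
  unfolding mat_norm_def
proof (rule cSUP_upper)
  show "bdd_above ((\<lambda>\<xi>. vec_norm n (mat_apply n x \<xi>)) ` {\<xi>. vec_norm n \<xi> \<le> 1})"
    by (rule bdd_aboveI2) (auto intro: vec_norm_mat_apply_le_sum)
qed (use assms in auto)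

lemma mat_norm_leI:
  assumes "\<And>\<xi>. vec_norm n \<xi> \<le> 1 \<Longrightarrow> vec_norm n (mat_apply n x \<xi>) \<le> c"
  shows "mat_norm n x \<le> c"
  unfolding mat_norm_def
proof (rule cSUP_least)
  \<comment> \<open>The zero vector witnesses that the unit ball is nonempty, as a least-upper-bound
    argument in the reals requires.\<close>
  have "vec_norm n (\<lambda>_. 0 :: 'a) \<le> 1"
    by (simp add: vec_norm_def)
  then show "{\<xi> :: nat \<Rightarrow> 'a. vec_norm n \<xi> \<le> 1} \<noteq> {}"
    by blast
qed (use assms in auto)

lemma mat_norm_nonneg: "0 \<le> mat_norm n (x :: nat \<Rightarrow> nat \<Rightarrow> 'h::chilbert_space \<Rightarrow>\<^sub>L 'h)"
proof -
  have "vec_norm n (\<lambda>_. 0 :: 'h) \<le> 1"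
    by (simp add: vec_norm_def)
  then show ?thesis
    by (meson order_trans vec_norm_mat_apply_le_mat_norm vec_norm_nonneg)
qed

lemma mat_apply_scaleR_right: "mat_apply n x (\<lambda>i. r *\<^sub>R \<xi> i) = (\<lambda>i. r *\<^sub>R mat_apply n x \<xi> i)"
  by (simp add: mat_apply_def blinfun.scaleR_right scaleR_sum_right)

lemma mat_apply_scaleR_left: "mat_apply n (\<lambda>i j. r *\<^sub>R x i j) \<xi> = (\<lambda>i. r *\<^sub>R mat_apply n x \<xi> i)"
  by (simp add: mat_apply_def blinfun.scaleR_left scaleR_sum_right)

lemma mat_apply_add_left:
  "mat_apply n (\<lambda>i j. x i j + y i j) \<xi> = (\<lambda>i. mat_apply n x \<xi> i + mat_apply n y \<xi> i)"
  by (simp add: mat_apply_def blinfun.add_left sum.distrib)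

text \<open>Follows from the bound on the unit ball by rescaling \<open>\<xi>\<close> to norm 1.
  Null vectors cannot be rescaled and are treated first.\<close>

lemma vec_norm_mat_apply_le: "vec_norm n (mat_apply n x \<xi>) \<le> mat_norm n x * vec_norm n \<xi>"
proof (cases "vec_norm n \<xi> = 0")
  case True
  \<comment> \<open>A null family vanishes only at indices below \<open>n\<close>, but
    \<open>mat_apply\<close> reads no others.\<close>
  then have "\<xi> i = 0" if "i < n" for i
    using norm_le_vec_norm[OF that, of \<xi>] by simp
  then have "mat_apply n x \<xi> = (\<lambda>_. 0)"
    by (auto simp: mat_apply_def blinfun.zero_right)
  then show ?thesis
    using True by (simp add: vec_norm_def)
next
  case False
  let ?r = "vec_norm n \<xi>"
  have pos: "0 < ?r"
    using False vec_norm_nonneg[of n \<xi>] by simp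
  then have "vec_norm n (mat_apply n x (\<lambda>i. (1 / ?r) *\<^sub>R \<xi> i)) \<le> mat_norm n x"
    by (intro vec_norm_mat_apply_le_mat_norm) (simp add: vec_norm_scaleR)
  then show ?thesis
    using pos by (simp add: mat_apply_scaleR_right vec_norm_scaleR field_simps)
qed

text \<open>Entries outside the \<open>n\<close> by \<open>n\<close> block are arbitrary and need
  not lie in the algebra, so later identities between matrices hold only inside the block; this
  passes them to the norm.\<close>

lemma mat_norm_cong:
  assumes "\<And>i j. i < n \<Longrightarrow> j < n \<Longrightarrow> x i j = y i j"
  shows "mat_norm n x = mat_norm n y"
proof -
  have "vec_norm n (mat_apply n x \<xi>) = vec_norm n (mat_apply n y \<xi>)" for \<xi>
    using assms by (auto simp: vec_norm_def mat_apply_def intro!: arg_cong[where f = sqrt] sum.cong)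
  then show ?thesis
    by (simp add: mat_norm_def)
qed

lemma mat_norm_triangle: "mat_norm n (\<lambda>i j. x i j + y i j) \<le> mat_norm n x + mat_norm n y"
proof (rule mat_norm_leI)
  fix \<xi> :: "nat \<Rightarrow> 'a" assume \<xi>: "vec_norm n \<xi> \<le> 1"
  have "vec_norm n (mat_apply n (\<lambda>i j. x i j + y i j) \<xi>)
      \<le> vec_norm n (mat_apply n x \<xi>) + vec_norm n (mat_apply n y \<xi>)"
    unfolding mat_apply_add_left by (rule vec_norm_triangle)
  also have "\<dots> \<le> mat_norm n x + mat_norm n y"
    using \<xi> by (intro add_mono vec_norm_mat_apply_le_mat_norm)
  finally show "vec_norm n (mat_apply n (\<lambda>i j. x i j + y i j) \<xi>) \<le> mat_norm n x + mat_norm n y" .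
qed

text \<open>The upper bound suffices for all uses: \<open>r = -1\<close> for signs,
  \<open>r = 0\<close> for vanishing matrices, and a norm or its reciprocal for
  normalisation.\<close>

lemma mat_norm_scaleR_le: "mat_norm n (\<lambda>i j. r *\<^sub>R x i j) \<le> \<bar>r\<bar> * mat_norm n x"
  by (rule mat_norm_leI)
    (simp add: mat_apply_scaleR_left vec_norm_scaleR mult_left_mono vec_norm_mat_apply_le_mat_norm)

lemma mat_norm_diff_commute: "mat_norm n (mat_diff x y) = mat_norm n (mat_diff y x)"
proof -
  have "mat_norm n (mat_diff x y) \<le> mat_norm n (mat_diff y x)" for x y :: "nat \<Rightarrow> nat \<Rightarrow> 'a \<Rightarrow>\<^sub>L 'a"
    using mat_norm_scaleR_le[of n "-1" "mat_diff y x"] by (simp add: mat_diff_def)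
  then show ?thesis
    by (simp add: order_antisym)
qed

lemma mat_norm_diff_le: "mat_norm n (mat_diff x y) \<le> mat_norm n x + mat_norm n y"
  using mat_norm_triangle[of n x "\<lambda>i j. (-1) *\<^sub>R y i j"] mat_norm_scaleR_le[of n "-1" y]
  by (simp add: mat_diff_def)

lemma mat_norm_diff_triangle:
  "mat_norm n (mat_diff x z) \<le> mat_norm n (mat_diff x y) + mat_norm n (mat_diff y z)"
  using mat_norm_triangle[of n "mat_diff x y" "mat_diff y z"] by (simp add: mat_diff_def)

text \<open>Serves to show that a matrix of norm 0 has zero entries, the degenerate case of the
  estimate by \<open>cb_norm\<close>.\<close>

lemma norm_entry_le_mat_norm:
  fixes x :: "nat \<Rightarrow> nat \<Rightarrow> 'h::chilbert_space \<Rightarrow>\<^sub>L 'h"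
  assumes "i < n" "j < n"
  shows "norm (x i j) \<le> mat_norm n x"
proof (rule norm_blinfun_bound[OF mat_norm_nonneg])
  fix v :: 'h
  \<comment> \<open>The vector \<open>v\<close> placed in coordinate \<open>j\<close> has the norm
    of \<open>v\<close>, and coordinate \<open>i\<close> of its image is \<open>x i j\<close>
    applied to \<open>v\<close>.\<close>
  let ?\<xi> = "\<lambda>k. if k = j then v else 0"
  have "mat_apply n x ?\<xi> i = (\<Sum>k<n. if k = j then blinfun_apply (x i j) v else 0)"
    unfolding mat_apply_def by (rule sum.cong) (auto simp: blinfun.zero_right)
  then have "mat_apply n x ?\<xi> i = blinfun_apply (x i j) v"
    using assms by simp
  then have "norm (blinfun_apply (x i j) v) \<le> vec_norm n (mat_apply n x ?\<xi>)"
    using norm_le_vec_norm[OF assms(1), of "mat_apply n x ?\<xi>"] by simp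
  also have "\<dots> \<le> mat_norm n x * vec_norm n ?\<xi>"
    by (rule vec_norm_mat_apply_le)
  also have "(\<Sum>k<n. (norm (?\<xi> k))\<^sup>2) = (\<Sum>k<n. if k = j then (norm v)\<^sup>2 else 0)"
    by (rule sum.cong) auto
  then have "vec_norm n ?\<xi> = norm v"
    using assms by (simp add: vec_norm_def)
  finally show "norm (blinfun_apply (x i j) v) \<le> mat_norm n x * norm v" .
qed

section \<open>Commutators\<close>

lemma mat_mult_amplify_left:
  assumes "i < n" shows "mat_mult n (amplify s) x i j = s o\<^sub>L x i j"
proof -
  have "mat_mult n (amplify s) x i j = (\<Sum>k<n. if k = i then s o\<^sub>L x i j else 0)"
    unfolding mat_mult_def amplify_def by (rule sum.cong) (auto simp: blinfun_eqI)
  then show ?thesis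
    using assms by simp
qed

lemma mat_mult_amplify_right:
  assumes "j < n" shows "mat_mult n x (amplify s) i j = x i j o\<^sub>L s"
proof -
  have "mat_mult n x (amplify s) i j = (\<Sum>k<n. if k = j then x i j o\<^sub>L s else 0)"
    unfolding mat_mult_def amplify_def
    by (rule sum.cong) (auto intro!: blinfun_eqI simp: blinfun.zero_right)
  then show ?thesis
    using assms by simp
qed

text \<open>The amplification of \<open>s\<close> acts as \<open>s\<close> on every coordinate, so
  the product applies \<open>s\<close> coordinatewise after \<open>x\<close>.\<close>

lemma mat_norm_mult_amplify_left_le:
  "mat_norm n (mat_mult n (amplify s) x) \<le> norm s * mat_norm n x"
proof (rule mat_norm_leI)
  fix \<xi> :: "nat \<Rightarrow> 'a" assume \<xi>: "vec_norm n \<xi> \<le> 1"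
  have "vec_norm n (mat_apply n (mat_mult n (amplify s) x) \<xi>)
      \<le> vec_norm n (\<lambda>i. blinfun_apply s (mat_apply n x \<xi> i))"
    by (rule vec_norm_mono) (simp add: mat_apply_def mat_mult_amplify_left blinfun.sum_right)
  also have "\<dots> \<le> norm s * mat_norm n x"
    by (rule order_trans[OF vec_norm_blinfun_apply_le])
      (simp add: mult_left_mono vec_norm_mat_apply_le_mat_norm \<xi>)
  finally show "vec_norm n (mat_apply n (mat_mult n (amplify s) x) \<xi>) \<le> norm s * mat_norm n x" .
qed

text \<open>Here \<open>s\<close> acts first, taking a unit vector to one of norm at most
  \<open>norm s\<close>; this is why the homogeneous estimate \<open>vec_norm_mat_apply_le\<close>
  is used.\<close>

lemma mat_norm_mult_amplify_right_le:
  "mat_norm n (mat_mult n x (amplify s)) \<le> norm s * mat_norm n x"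
proof (rule mat_norm_leI)
  fix \<xi> :: "nat \<Rightarrow> 'a" assume \<xi>: "vec_norm n \<xi> \<le> 1"
  have "vec_norm n (\<lambda>i. blinfun_apply s (\<xi> i)) \<le> norm s"
    by (rule order_trans[OF vec_norm_blinfun_apply_le]) (simp add: \<xi> mult_left_le)
  then have "mat_norm n x * vec_norm n (\<lambda>i. blinfun_apply s (\<xi> i)) \<le> norm s * mat_norm n x"
    by (subst mult.commute) (rule mult_right_mono[OF _ mat_norm_nonneg])
  moreover have "mat_apply n (mat_mult n x (amplify s)) \<xi>
      = mat_apply n x (\<lambda>i. blinfun_apply s (\<xi> i))"
    by (simp add: mat_apply_def mat_mult_amplify_right)
  ultimately show "vec_norm n (mat_apply n (mat_mult n x (amplify s)) \<xi>) \<le> norm s * mat_norm n x"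
    using vec_norm_mat_apply_le[of n x "\<lambda>i. blinfun_apply s (\<xi> i)"] by simp
qed

lemma mat_norm_commutator_amplify_le:
  "mat_norm n (mat_commutator n (amplify s) x) \<le> 2 * norm s * mat_norm n x"
  unfolding mat_commutator_def
  using mat_norm_diff_le[of n "mat_mult n (amplify s) x" "mat_mult n x (amplify s)"]
    mat_norm_mult_amplify_left_le[of n s x] mat_norm_mult_amplify_right_le[of n x s]
  by linarith

lemma mat_commutator_diff_right:
  "mat_commutator n a (mat_diff x y) = mat_diff (mat_commutator n a x) (mat_commutator n a y)"
  by (intro ext)
    (simp add: mat_commutator_def mat_diff_def mat_mult_def
      bounded_bilinear.diff_right[OF bounded_bilinear_blinfun_compose]
      bounded_bilinear.diff_left[OF bounded_bilinear_blinfun_compose] sum_subtractf algebra_simps)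

text \<open>Each commutator is a difference of two products, each at most \<open>norm s\<close>
  times the norm of \<open>x\<close>; hence the factor 2. For empty \<open>S\<close> both sides are
  0.\<close>

lemma lip_seminorm_le: "lip_seminorm S n x \<le> 2 * (SUP s\<in>S. ennreal (norm s)) * ennreal (mat_norm n x)"
  unfolding lip_seminorm_def
proof (rule SUP_least)
  fix s assume s: "s \<in> S"
  have "ennreal (mat_norm n (mat_commutator n (amplify s) x)) \<le> ennreal (2 * norm s * mat_norm n x)"
    by (intro ennreal_leI mat_norm_commutator_amplify_le)
  also have "\<dots> = 2 * ennreal (norm s) * ennreal (mat_norm n x)"
    by (simp add: ennreal_mult mat_norm_nonneg)
  also have "\<dots> \<le> 2 * (SUP s\<in>S. ennreal (norm s)) * ennreal (mat_norm n x)"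
    by (intro mult_right_mono mult_left_mono SUP_upper s) auto
  finally show "ennreal (mat_norm n (mat_commutator n (amplify s) x))
      \<le> 2 * (SUP s\<in>S. ennreal (norm s)) * ennreal (mat_norm n x)" .
qed

lemma lip_seminorm_le_add_diff:
  "lip_seminorm S n y \<le> lip_seminorm S n x + lip_seminorm S n (mat_diff x y)"
  unfolding lip_seminorm_def
proof (rule SUP_least)
  fix s assume s: "s \<in> S"
  let ?c = "mat_commutator n (amplify s)"
  have "mat_norm n (?c y) \<le> mat_norm n (?c x) + mat_norm n (?c (mat_diff x y))"
    \<comment> \<open>By linearity of the commutator, \<open>?c y\<close> is \<open>?c x\<close>
      minus \<open>?c (mat_diff x y)\<close>.\<close>
    using mat_norm_diff_le[of n "?c x" "?c (mat_diff x y)"]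
    unfolding mat_commutator_diff_right by (simp add: mat_diff_def)
  then have "ennreal (mat_norm n (?c y))
      \<le> ennreal (mat_norm n (?c x)) + ennreal (mat_norm n (?c (mat_diff x y)))"
    by (simp add: ennreal_leI mat_norm_nonneg flip: ennreal_plus)
  also have "\<dots> \<le> (SUP s\<in>S. ennreal (mat_norm n (mat_commutator n (amplify s) x)))
      + (SUP s\<in>S. ennreal (mat_norm n (mat_commutator n (amplify s) (mat_diff x y))))"
    by (intro add_mono SUP_upper s)
  finally show "ennreal (mat_norm n (?c y)) \<le> \<dots>" .
qed

section \<open>Completely bounded norms\<close>

lemma cscale_of_real: "cscale (complex_of_real r) T = r *\<^sub>R T"
  by (rule blinfun_eqI) (simp add: cscale_apply scaleC_of_real blinfun.scaleR_left)

lemma von_neumann_algebra_scaleR: "von_neumann_algebra N \<Longrightarrow> a \<in> N \<Longrightarrow> r *\<^sub>R a \<in> N"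
  unfolding von_neumann_algebra_def by (metis cscale_of_real)

text \<open>The closure axioms speak of sums and scalar multiples, so a difference is written with
  the scalar -1; \<open>linear_map_on_diff\<close> proceeds in the same way.\<close>

lemma von_neumann_algebra_diff:
  assumes N: "von_neumann_algebra N" and ab: "a \<in> N" "b \<in> N"
  shows "a - b \<in> N"
proof -
  have "a + (-1) *\<^sub>R b \<in> N"
    using N ab von_neumann_algebra_scaleR[OF N] unfolding von_neumann_algebra_def by blast
  then show ?thesis
    by simp
qed

lemma linear_map_on_scaleR: "linear_map_on N \<Phi> \<Longrightarrow> a \<in> N \<Longrightarrow> \<Phi> (r *\<^sub>R a) = r *\<^sub>R \<Phi> a"
  unfolding linear_map_on_def by (metis cscale_of_real)

lemma linear_map_on_diff:
  assumes N: "von_neumann_algebra N" and \<Phi>: "linear_map_on N \<Phi>" and ab: "a \<in> N" "b \<in> N"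
  shows "\<Phi> (a - b) = \<Phi> a - \<Phi> b"
proof -
  have "\<Phi> (a + (-1) *\<^sub>R b) = \<Phi> a + \<Phi> ((-1) *\<^sub>R b)"
    using \<Phi> ab von_neumann_algebra_scaleR[OF N] unfolding linear_map_on_def by blast
  then show ?thesis
    using linear_map_on_scaleR[OF \<Phi> ab(2), of "-1"] by simp
qed

lemma linear_map_on_minus:
  assumes "linear_map_on N \<Phi>" "linear_map_on N \<Psi>"
  shows "linear_map_on N (\<lambda>x. \<Phi> x - \<Psi> x)"
proof -
  have "cscale c a - cscale c b = cscale c (a - b)" for c and a b :: "'a \<Rightarrow>\<^sub>L 'a"
  proof (rule blinfun_eqI)
    fix \<xi>
    \<comment> \<open>Additivity of \<open>scaleC\<close> is the class axiom; compatibility with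
      subtraction is obtained by moving a term across.\<close>
    have "scaleC c (u - v) + scaleC c v = scaleC c u" for u v :: 'a
      by (metis diff_add_cancel scaleC_add_right)
    then show "blinfun_apply (cscale c a - cscale c b) \<xi> = blinfun_apply (cscale c (a - b)) \<xi>"
      by (simp add: cscale_apply blinfun.diff_left diff_eq_eq)
  qed
  then show ?thesis
    using assms by (auto simp: linear_map_on_def)
qed

text \<open>By homogeneity: \<open>y\<close> is divided by its norm to enter the unit ball over
  which \<open>cb_norm\<close> is a supremum. The estimate lives in \<open>[0,\<infinity>]\<close>,
  as \<open>cb_norm\<close> may be infinite a priori.\<close>

lemma mat_norm_mat_map_le_cb_norm:
  assumes N: "von_neumann_algebra N" and \<Psi>: "linear_map_on N \<Psi>"
    and n: "n \<ge> 1" and y: "y \<in> mats n N"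
  shows "ennreal (mat_norm n (mat_map \<Psi> y)) \<le> ennreal (mat_norm n y) * cb_norm N \<Psi>"
proof (cases "mat_norm n y = 0")
  \<comment> \<open>Since \<open>0 * \<infinity> = 0\<close>, the right-hand side is 0 whatever
    \<open>cb_norm\<close> is, so the image must be shown to vanish.\<close>
  case True
  have "mat_map \<Psi> y i j = 0" if ij: "i < n" "j < n" for i j
  proof -
    have "y i j = 0"
      using norm_entry_le_mat_norm[OF ij, of y] True by simp
    moreover have "y i j \<in> N"
      using y ij by (simp add: mats_def)
    ultimately show ?thesis
      \<comment> \<open>Homogeneity with the scalar 0 gives that \<open>\<Psi>\<close> maps 0 to
        0.\<close>
      using linear_map_on_scaleR[OF \<Psi>, of "y i j" 0] by (simp add: mat_map_def)
  qed
  then have "mat_norm n (mat_map \<Psi> y) = mat_norm n (\<lambda>i j. 0 *\<^sub>R y i j)"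
    by (intro mat_norm_cong) simp
  then have "mat_norm n (mat_map \<Psi> y) \<le> 0"
    using mat_norm_scaleR_le[of n 0 y] by simp
  then show ?thesis
    by (simp add: ennreal_neg)
next
  case False
  let ?r = "mat_norm n y" and ?z = "\<lambda>i j. (1 / mat_norm n y) *\<^sub>R y i j"
  have pos: "0 < ?r"
    using False mat_norm_nonneg[of n y] by simp
  have z: "?z \<in> mats n N"
    using y by (simp add: mats_def von_neumann_algebra_scaleR[OF N])
  have z1: "mat_norm n ?z \<le> 1"
    using mat_norm_scaleR_le[of n "1 / ?r" y] pos by simp
  have "mat_norm n (mat_map \<Psi> y) = mat_norm n (\<lambda>i j. ?r *\<^sub>R mat_map \<Psi> ?z i j)"
  proof (rule mat_norm_cong)
    fix i j assume "i < n" "j < n"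
    then have "y i j \<in> N"
      using y by (simp add: mats_def)
    then show "mat_map \<Psi> y i j = ?r *\<^sub>R mat_map \<Psi> ?z i j"
      using False by (simp add: mat_map_def linear_map_on_scaleR[OF \<Psi>])
  qed
  also have "\<dots> \<le> ?r * mat_norm n (mat_map \<Psi> ?z)"
    using mat_norm_scaleR_le[of n ?r "mat_map \<Psi> ?z"] pos by simp
  finally have "ennreal (mat_norm n (mat_map \<Psi> y))
      \<le> ennreal ?r * ennreal (mat_norm n (mat_map \<Psi> ?z))"
    using pos by (simp add: ennreal_leI mat_norm_nonneg flip: ennreal_mult)
  also have "ennreal (mat_norm n (mat_map \<Psi> ?z)) \<le> cb_norm N \<Psi>"
    unfolding cb_norm_def
  proof (rule SUP_upper2[of n], goal_cases)
    case 2
    show ?case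
      by (rule SUP_upper2[of ?z]) (use z z1 in auto)
  qed (use n in auto)
  finally show ?thesis
    by (simp add: mult_left_mono)
qed

section \<open>Perturbation of the cost and of the Lipschitz constant\<close>

text \<open>The matrix \<open>?y\<close> is oriented as \<open>E x - x\<close>, so that its norm is
  literally a member of the supremum \<open>Cost_cb N S E\<close>. The resulting sign is absorbed by
  the symmetry of the norm of a difference.\<close>

lemma mat_norm_map_diff_le_Cost_cb:
  assumes N: "von_neumann_algebra N"
    and lin: "linear_map_on N \<Phi>" "linear_map_on N \<Psi>"
    and E: "\<And>x. x \<in> N \<Longrightarrow> E x \<in> N"
    and fix_E: "\<And>x. x \<in> N \<Longrightarrow> \<Phi> (E x) = \<Psi> (E x)"
    and n: "n \<ge> 1" and x: "x \<in> lip_ball N S n"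
  shows "ennreal (mat_norm n (mat_diff (mat_map \<Phi> x) (mat_map \<Psi> x)))
    \<le> Cost_cb N S E * cb_norm N (\<lambda>x. \<Phi> x - \<Psi> x)"
proof -
  let ?y = "mat_diff (mat_map E x) x" and ?\<Delta> = "\<lambda>x. \<Phi> x - \<Psi> x"
  note lin\<Delta> = linear_map_on_minus[OF lin]
  have xN: "x i j \<in> N" if "i < n" "j < n" for i j
    using x that by (simp add: lip_ball_def mats_def)
  have y: "?y \<in> mats n N"
    by (simp add: mats_def mat_diff_def mat_map_def xN E von_neumann_algebra_diff[OF N])
  have "mat_norm n (mat_diff (mat_map \<Phi> x) (mat_map \<Psi> x))
      = mat_norm n (mat_diff (mat_map \<Psi> x) (mat_map \<Phi> x))"
    by (rule mat_norm_diff_commute)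
  \<comment> \<open>Entrywise, the values of \<open>\<Phi>\<close> and \<open>\<Psi>\<close> at
    \<open>E x\<close> cancel and leave \<open>\<Psi> x - \<Phi> x\<close>.\<close>
  also have "\<dots> = mat_norm n (mat_map ?\<Delta> ?y)"
    by (rule mat_norm_cong)
      (simp add: mat_map_def mat_diff_def xN E fix_E linear_map_on_diff[OF N lin(1)]
        linear_map_on_diff[OF N lin(2)])
  finally have "ennreal (mat_norm n (mat_diff (mat_map \<Phi> x) (mat_map \<Psi> x)))
      \<le> ennreal (mat_norm n ?y) * cb_norm N ?\<Delta>"
    using mat_norm_mat_map_le_cb_norm[OF N lin\<Delta> n y] by simp
  also have "ennreal (mat_norm n ?y) \<le> Cost_cb N S E"
    unfolding Cost_cb_def
    by (rule SUP_upper2[of n]) (use n x in \<open>auto intro: SUP_upper\<close>)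
  finally show ?thesis
    by (simp add: mult_right_mono)
qed

text \<open>Triangle inequality through \<open>mat_map \<Psi> x\<close>, uniformly over the
  Lipschitz ball. The one-sided additive form avoids truncated subtraction and stays meaningful for
  infinite costs.\<close>

lemma Cost_cb_le_add:
  assumes "\<And>n x. n \<ge> 1 \<Longrightarrow> x \<in> lip_ball N S n \<Longrightarrow>
    ennreal (mat_norm n (mat_diff (mat_map \<Phi> x) (mat_map \<Psi> x))) \<le> C"
  shows "Cost_cb N S \<Phi> \<le> Cost_cb N S \<Psi> + C"
  unfolding Cost_cb_def[of N S \<Phi>]
proof (intro SUP_least)
  fix n x assume n: "n \<in> {1::nat..}" and x: "x \<in> lip_ball N S n"
  have "ennreal (mat_norm n (mat_diff (mat_map \<Phi> x) x))
      \<le> ennreal (mat_norm n (mat_diff (mat_map \<Psi> x) x))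
        + ennreal (mat_norm n (mat_diff (mat_map \<Phi> x) (mat_map \<Psi> x)))"
    using mat_norm_diff_triangle[of n "mat_map \<Phi> x" x "mat_map \<Psi> x"]
    by (simp add: ennreal_leI mat_norm_nonneg add.commute flip: ennreal_plus)
  also have "\<dots> \<le> Cost_cb N S \<Psi> + C"
  proof (rule add_mono)
    show "ennreal (mat_norm n (mat_diff (mat_map \<Psi> x) x)) \<le> Cost_cb N S \<Psi>"
      unfolding Cost_cb_def by (rule SUP_upper2[of n]) (use n x in \<open>auto intro: SUP_upper\<close>)
  qed (use assms n x in auto)
  finally show "ennreal (mat_norm n (mat_diff (mat_map \<Phi> x) x)) \<le> Cost_cb N S \<Psi> + C" .
qed

text \<open>The uniform norm bound \<open>C\<close> becomes a seminorm bound by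
  \<open>lip_seminorm_le\<close>, and the triangle inequality for the seminorm gives the
  rest.\<close>

lemma Lip_cb_le_add:
  assumes "\<And>n x. n \<ge> 1 \<Longrightarrow> x \<in> lip_ball N S n \<Longrightarrow>
    ennreal (mat_norm n (mat_diff (mat_map \<Phi> x) (mat_map \<Psi> x))) \<le> C"
  shows "Lip_cb N S \<Psi> \<le> Lip_cb N S \<Phi> + 2 * (SUP s\<in>S. ennreal (norm s)) * C"
  unfolding Lip_cb_def[of N S \<Psi>]
proof (intro SUP_least)
  fix n x assume n: "n \<in> {1::nat..}" and x: "x \<in> lip_ball N S n"
  let ?d = "mat_diff (mat_map \<Phi> x) (mat_map \<Psi> x)"
  have "lip_seminorm S n ?d \<le> 2 * (SUP s\<in>S. ennreal (norm s)) * ennreal (mat_norm n ?d)"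
    by (rule lip_seminorm_le)
  also have "\<dots> \<le> 2 * (SUP s\<in>S. ennreal (norm s)) * C"
    using assms n x by (intro mult_left_mono) auto
  finally have d: "lip_seminorm S n ?d \<le> 2 * (SUP s\<in>S. ennreal (norm s)) * C" .
  have "lip_seminorm S n (mat_map \<Phi> x) \<le> Lip_cb N S \<Phi>"
    unfolding Lip_cb_def by (rule SUP_upper2[of n]) (use n x in \<open>auto intro: SUP_upper\<close>)
  then show "lip_seminorm S n (mat_map \<Psi> x)
      \<le> Lip_cb N S \<Phi> + 2 * (SUP s\<in>S. ennreal (norm s)) * C"
    using d by (intro order_trans[OF lip_seminorm_le_add_diff add_mono])
qed

text \<open>If \<open>a\<close> and \<open>b\<close> are both infinite, the value is 0 by
  convention; if exactly one is, the assumptions force \<open>c\<close> to be infinite.\<close>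

lemma abs_diff_le:
  assumes "a \<le> b + c" "b \<le> a + c"
  shows "abs_diff a b \<le> c"
  using assms by (auto simp: abs_diff_def ennreal_minus_le_iff)

theorem proposition3p15:
  fixes N S :: "('h::chilbert_space \<Rightarrow>\<^sub>L 'h) set"
    and Efix \<Phi>1 \<Phi>2 :: "('h \<Rightarrow>\<^sub>L 'h) \<Rightarrow> ('h \<Rightarrow>\<^sub>L 'h)"
  assumes "von_neumann_algebra N"
    and "finite S" and "S \<subseteq> bounded_ops"
    and "von_neumann_algebra (commutant S)"
    and "conditional_expectation N (commutant S \<inter> N) Efix"
    and "normal_map N (commutant S \<inter> N) Efix"
    and "channel N \<Phi>1" and "channel N \<Phi>2"
    and "\<forall>x\<in>N. \<Phi>1 (Efix x) = Efix x"
    and "\<forall>x\<in>N. \<Phi>2 (Efix x) = Efix x"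
  shows "abs_diff (Cost_cb N S \<Phi>2) (Cost_cb N S \<Phi>1)
           \<le> Cost_cb N S Efix * cb_norm N (\<lambda>x. \<Phi>1 x - \<Phi>2 x) \<and>
         abs_diff (Lip_cb N S \<Phi>2) (Lip_cb N S \<Phi>1)
           \<le> 2 * (SUP s\<in>S. ennreal (norm s)) * Cost_cb N S Efix
               * cb_norm N (\<lambda>x. \<Phi>1 x - \<Phi>2 x)"
proof -
  let ?C = "Cost_cb N S Efix * cb_norm N (\<lambda>x. \<Phi>1 x - \<Phi>2 x)"
  have lin: "linear_map_on N \<Phi>1" "linear_map_on N \<Phi>2"
    using assms(7,8) by (auto simp: channel_def ucp_map_def)
  have E: "Efix x \<in> N" if "x \<in> N" for x
    using assms(5) that by (auto simp: conditional_expectation_def ucp_map_def)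
  have bound12: "ennreal (mat_norm n (mat_diff (mat_map \<Phi>1 x) (mat_map \<Phi>2 x))) \<le> ?C"
    if "n \<ge> 1" "x \<in> lip_ball N S n" for n x
    by (rule mat_norm_map_diff_le_Cost_cb[OF assms(1) lin]) (use E assms(9,10) that in auto)
  \<comment> \<open>The absolute difference requires both one-sided estimates, hence the same bound
    with the channels exchanged.\<close>
  then have bound21: "ennreal (mat_norm n (mat_diff (mat_map \<Phi>2 x) (mat_map \<Phi>1 x))) \<le> ?C"
    if "n \<ge> 1" "x \<in> lip_ball N S n" for n x
    using that by (simp add: mat_norm_diff_commute[of n "mat_map \<Phi>2 x"])
  have "abs_diff (Cost_cb N S \<Phi>2) (Cost_cb N S \<Phi>1) \<le> ?C"
    by (intro abs_diff_le Cost_cb_le_add bound12 bound21)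
  moreover have "abs_diff (Lip_cb N S \<Phi>2) (Lip_cb N S \<Phi>1)
      \<le> 2 * (SUP s\<in>S. ennreal (norm s)) * ?C"
    by (intro abs_diff_le Lip_cb_le_add bound12 bound21)
  ultimately show ?thesis
    by (simp add: mult.assoc)
qed

end
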